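(* Let $\Psi$ be a $\mathsf{Max\text{-}2AND}$ instance with $m\ge1$ clauses and $\mathrm{bias}(\Psi)\le m/3$. Then $$\mathrm{val}_\Psi\ \ge\ \frac m4+\frac{\mathrm{bias}(\Psi)^2}{4\,(m-2\,\mathrm{bias}(\Psi))}\ \ge\ \frac{2\,(m+\mathrm{bias}(\Psi))}{9}.$$
   Context: A $\mathsf{Max\text{-}2AND}$ instance $\Psi$ consists of Boolean variables $x_1,\dots,x_n$ and a list of $m$ clauses, each a conjunction of exactly two, not necessarily distinct, literals (a clause consisting of a single literal $\ell$ is written as $\ell\wedge\ell$). No clause is unsatisfiable, i.e. no clause has the form $x_i\wedge\neg x_i$. $\mathrm{val}_\Psi$ is the maximum over all assignments of the number of satisfied clauses. Let $\mathrm{pos}_i(\Psi)$ and $\mathrm{neg}_i(\Psi)$ be the numbers of occurrences of the literals $x_i$ and $\neg x_i$ in the clauses of $\Psi$, counted with multiplicity (so $x_i\wedge x_i$ contributes $2$ to $\mathrm{pos}_i$). Then $$\mathrm{bias}(\Psi)=\frac12\sum_{i=1}^n|\mathrm{pos}_i(\Psi)-\mathrm{neg}_i(\Psi)|.$$ *)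

theory Defs
  imports Complex_Main "HOL-Library.FuncSet"
begin

datatype literal = Pos nat | Neg nat

fun var :: "literal \<Rightarrow> nat" where
  "var (Pos i) = i"
| "var (Neg i) = i"

fun negate :: "literal \<Rightarrow> literal" where
  "negate (Pos i) = Neg i"
| "negate (Neg i) = Pos i"

text \<open>The pair of literals \<open>(l, l')\<close> stands for the conjunction of \<open>l\<close> and \<open>l'\<close>.\<close>

type_synonym clause = "literal \<times> literal"

text \<open>Instances on the variables \<open>x\<^sub>1, \<dots>, x\<^sub>n\<close>. The clauses form a list, so clauses may be
  repeated; the two literals of a clause may coincide but are never complementary.\<close>

definition max2and_instance :: "nat \<Rightarrow> clause list \<Rightarrow> bool" where
  "max2and_instance n \<Psi> \<longleftrightarrow>
     (\<forall>(l, l') \<in> set \<Psi>. var l \<in> {1..n} \<and> var l' \<in> {1..n} \<and> l' \<noteq> negate l)"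

fun lit_true :: "(nat \<Rightarrow> bool) \<Rightarrow> literal \<Rightarrow> bool" where
  "lit_true \<sigma> (Pos i) \<longleftrightarrow> \<sigma> i"
| "lit_true \<sigma> (Neg i) \<longleftrightarrow> \<not> \<sigma> i"

definition clause_true :: "(nat \<Rightarrow> bool) \<Rightarrow> clause \<Rightarrow> bool" where
  "clause_true \<sigma> c \<longleftrightarrow> lit_true \<sigma> (fst c) \<and> lit_true \<sigma> (snd c)"

definition num_sat :: "(nat \<Rightarrow> bool) \<Rightarrow> clause list \<Rightarrow> nat" where
  "num_sat \<sigma> \<Psi> = length (filter (clause_true \<sigma>) \<Psi>)"

definition val :: "nat \<Rightarrow> clause list \<Rightarrow> nat" where
  "val n \<Psi> = Max ((\<lambda>\<sigma>. num_sat \<sigma> \<Psi>) ` ({1..n} \<rightarrow>\<^sub>E (UNIV :: bool set)))"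

definition occurrences :: "literal \<Rightarrow> clause list \<Rightarrow> nat" where
  "occurrences l \<Psi> = count_list (map fst \<Psi>) l + count_list (map snd \<Psi>) l"

definition pos :: "nat \<Rightarrow> clause list \<Rightarrow> nat" where
  "pos i \<Psi> = occurrences (Pos i) \<Psi>"

definition neg :: "nat \<Rightarrow> clause list \<Rightarrow> nat" where
  "neg i \<Psi> = occurrences (Neg i) \<Psi>"

definition bias :: "nat \<Rightarrow> clause list \<Rightarrow> real" where
  "bias n \<Psi> = (1 / 2) * (\<Sum>i = 1..n. \<bar>real (pos i \<Psi>) - real (neg i \<Psi>)\<bar>)"

end

theory Submission
  imports Defs
begin

text \<open>Set every variable independently to its majority value with probability \<open>1/2 + g\<close>. With
  \<open>s(\<ell>) = 1\<close> for literals true under the majority assignment and \<open>-1\<close> otherwise, a clause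
  \<open>\<ell> \<and> \<ell>'\<close> is satisfied with probability at least
  \<open>(1/2 + g s(\<ell>)) (1/2 + g s(\<ell>'))\<close>. Since \<open>s s' \<ge> s + s' - 1\<close> and the values \<open>s + s'\<close> add up to
  twice the bias \<open>B\<close>, the expected number of satisfied clauses is at least
  \<open>m/4 + g B - g\<^sup>2 (m - 2 B)\<close>, which is maximal at \<open>g = B / (2 (m - 2 B))\<close>; the hypothesis
  \<open>B \<le> m/3\<close> says exactly that this \<open>g\<close> is at most \<open>1/2\<close>.\<close>

definition lit_sign :: "(nat \<Rightarrow> bool) \<Rightarrow> literal \<Rightarrow> real" where
  "lit_sign \<tau> l = (if lit_true \<tau> l then 1 else -1)"

lemma lit_sign_simps [simp]:
  "lit_sign \<tau> (Pos i) = (if \<tau> i then 1 else -1)"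
  "lit_sign \<tau> (Neg i) = (if \<tau> i then -1 else 1)"
  by (auto simp: lit_sign_def)

definition assignment_weight :: "(nat \<Rightarrow> bool \<Rightarrow> real) \<Rightarrow> nat set \<Rightarrow> (nat \<Rightarrow> bool) \<Rightarrow> real" where
  "assignment_weight w I \<sigma> = (\<Prod>i\<in>I. w i (\<sigma> i))"

text \<open>Coordinates are independent under a product weight. Padding \<open>f\<close> with the
  factor 1 outside \<open>S\<close> makes the product run over all of \<open>I\<close>, so that sum
  and product can be exchanged; each coordinate outside \<open>S\<close> then contributes its total
  weight 1.\<close>

lemma expectation_prod:
  fixes f :: "nat \<Rightarrow> bool \<Rightarrow> real"
  assumes "finite I" "S \<subseteq> I" and w: "\<And>i. w i True + w i False = 1"
  shows "(\<Sum>\<sigma>\<in>I \<rightarrow>\<^sub>E UNIV. assignment_weight w I \<sigma> * (\<Prod>i\<in>S. f i (\<sigma> i)))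
       = (\<Prod>i\<in>S. w i True * f i True + w i False * f i False)"
proof -
  define h where "h i b = w i b * (if i \<in> S then f i b else 1)" for i b
  have "assignment_weight w I \<sigma> * (\<Prod>i\<in>S. f i (\<sigma> i)) = (\<Prod>i\<in>I. h i (\<sigma> i))" for \<sigma>
    using assms(1,2)
    by (simp add: assignment_weight_def h_def prod.distrib prod.inter_restrict[symmetric] Int_absorb1)
  then have "(\<Sum>\<sigma>\<in>I \<rightarrow>\<^sub>E UNIV. assignment_weight w I \<sigma> * (\<Prod>i\<in>S. f i (\<sigma> i)))
           = (\<Prod>i\<in>I. \<Sum>b\<in>UNIV. h i b)"
    using assms(1) by (simp add: prod_sum_PiE)
  also have "\<dots> = (\<Prod>i\<in>I. if i \<in> S then w i True * f i True + w i False * f i False else 1)"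
    by (rule prod.cong) (use w in \<open>auto simp: h_def UNIV_bool add.commute\<close>)
  also have "\<dots> = (\<Prod>i\<in>S. w i True * f i True + w i False * f i False)"
    using assms(1,2) by (simp add: prod.inter_restrict[symmetric] Int_absorb1)
  finally show ?thesis .
qed

lemma sum_assignment_weight:
  assumes "finite I" and "\<And>i. w i True + w i False = 1"
  shows "(\<Sum>\<sigma>\<in>I \<rightarrow>\<^sub>E UNIV. assignment_weight w I \<sigma>) = 1"
  using expectation_prod[of I "{}" w] assms by simp

definition shifted_weight :: "(nat \<Rightarrow> bool) \<Rightarrow> real \<Rightarrow> nat \<Rightarrow> bool \<Rightarrow> real" where
  "shifted_weight \<tau> g i b = (if b = \<tau> i then 1/2 + g else 1/2 - g)"

text \<open>Distinct literals that are not complementary have distinct variables, so independence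
  gives equality. If \<open>l = l'\<close>, the probability is p = 1/2 + g s instead of p * p, and p
  \<ge> p * p because the bounds on \<open>g\<close> keep p between 0 and 1.\<close>

lemma clause_probability_ge:
  assumes "finite I" "var l \<in> I" "var l' \<in> I" "l' \<noteq> negate l" and g: "0 \<le> g" "g \<le> 1/2"
  shows "(\<Sum>\<sigma>\<in>I \<rightarrow>\<^sub>E UNIV. assignment_weight (shifted_weight \<tau> g) I \<sigma> * of_bool (clause_true \<sigma> (l, l')))
       \<ge> (1/2 + g * lit_sign \<tau> l) * (1/2 + g * lit_sign \<tau> l')"
proof -
  \<comment> \<open>Each factor tests both literals, so the product over
    \<open>{var l, var l'}\<close> stays correct when this set collapses to a single
    variable.\<close>
  define f :: "nat \<Rightarrow> bool \<Rightarrow> real" where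
    "f i b = of_bool ((i = var l \<longrightarrow> lit_true (\<lambda>_. b) l) \<and> (i = var l' \<longrightarrow> lit_true (\<lambda>_. b) l'))" for i b
  have "of_bool (clause_true \<sigma> (l, l')) = (\<Prod>i\<in>{var l, var l'}. f i (\<sigma> i))" for \<sigma>
    by (cases l; cases l') (auto simp: f_def clause_true_def)
  then have "(\<Sum>\<sigma>\<in>I \<rightarrow>\<^sub>E UNIV. assignment_weight (shifted_weight \<tau> g) I \<sigma> * of_bool (clause_true \<sigma> (l, l')))
           = (\<Prod>i\<in>{var l, var l'}. shifted_weight \<tau> g i True * f i True + shifted_weight \<tau> g i False * f i False)"
    using assms(1-3) by (simp only:) (rule expectation_prod, auto simp: shifted_weight_def)
  also have "\<dots> = (if l = l' then 1/2 + g * lit_sign \<tau> l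
                   else (1/2 + g * lit_sign \<tau> l) * (1/2 + g * lit_sign \<tau> l'))"
    using assms(4) by (cases l; cases l') (auto simp: f_def shifted_weight_def)
  also have "\<dots> \<ge> (1/2 + g * lit_sign \<tau> l) * (1/2 + g * lit_sign \<tau> l')"
    using g by (auto simp: lit_sign_def intro: mult_left_le)
  finally show ?thesis .
qed

lemma num_sat_eq_sum_list: "real (num_sat \<sigma> \<Psi>) = (\<Sum>c\<leftarrow>\<Psi>. of_bool (clause_true \<sigma> c))"
  by (induction \<Psi>) (auto simp: num_sat_def)

lemma num_sat_le_val:
  assumes "\<sigma> \<in> {1..n} \<rightarrow>\<^sub>E UNIV"
  shows "num_sat \<sigma> \<Psi> \<le> val n \<Psi>"
  unfolding val_def using assms by (intro Max_ge) (auto intro!: finite_PiE)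

text \<open>A weighted average with nonnegative weights of total 1 cannot exceed the
  maximum.\<close>

lemma expected_num_sat_le_val:
  assumes "\<And>i b. w i b \<ge> 0" and "\<And>i. w i True + w i False = 1"
  shows "(\<Sum>\<sigma>\<in>{1..n} \<rightarrow>\<^sub>E UNIV. assignment_weight w {1..n} \<sigma> * real (num_sat \<sigma> \<Psi>)) \<le> real (val n \<Psi>)"
proof -
  have "(\<Sum>\<sigma>\<in>{1..n} \<rightarrow>\<^sub>E UNIV. assignment_weight w {1..n} \<sigma> * real (num_sat \<sigma> \<Psi>))
      \<le> (\<Sum>\<sigma>\<in>{1..n} \<rightarrow>\<^sub>E UNIV. assignment_weight w {1..n} \<sigma> * real (val n \<Psi>))"
    using assms(1)
    by (intro sum_mono mult_left_mono) (auto simp: num_sat_le_val assignment_weight_def intro: prod_nonneg)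
  then show ?thesis
    using assms(2) by (simp add: sum_distrib_right[symmetric] sum_assignment_weight)
qed

definition majority :: "clause list \<Rightarrow> nat \<Rightarrow> bool" where
  "majority \<Psi> i \<longleftrightarrow> neg i \<Psi> \<le> pos i \<Psi>"

text \<open>Double counting of literal occurrences, grouped by clause and by variable. The
  assignment \<open>\<tau>\<close> is arbitrary because the majority assignment depends on
  \<open>\<Psi>\<close> and would change during the induction.\<close>

lemma sum_lit_sign:
  assumes "max2and_instance n \<Psi>"
  shows "(\<Sum>(l, l')\<leftarrow>\<Psi>. lit_sign \<tau> l + lit_sign \<tau> l')
       = (\<Sum>i = 1..n. (if \<tau> i then 1 else -1) * (real (pos i \<Psi>) - real (neg i \<Psi>)))"
  using assms
proof (induction \<Psi>)
  case Nil
  then show ?case by (simp add: pos_def neg_def occurrences_def)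
next
  case (Cons c \<Psi>)
  define t :: "nat \<Rightarrow> real" where "t i = (if \<tau> i then 1 else -1)" for i
  have single: "(\<Sum>i = 1..n. t i * (of_bool (l = Pos i) - of_bool (l = Neg i))) = lit_sign \<tau> l"
    if "var l \<in> {1..n}" for l
  proof -
    have "t i * (of_bool (l = Pos i) - of_bool (l = Neg i)) = (if i = var l then lit_sign \<tau> l else 0)" for i
      by (cases l) (auto simp: t_def)
    with that show ?thesis by simp
  qed
  obtain l l' where c: "c = (l, l')" by fastforce
  have "t i * (real (pos i (c # \<Psi>)) - real (neg i (c # \<Psi>)))
      = t i * (of_bool (l = Pos i) - of_bool (l = Neg i))
      + t i * (of_bool (l' = Pos i) - of_bool (l' = Neg i))
      + t i * (real (pos i \<Psi>) - real (neg i \<Psi>))" for i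
    by (auto simp: c pos_def neg_def occurrences_def algebra_simps)
  with Cons show ?case
    using single[of l] single[of l'] by (simp add: c t_def[symmetric] max2and_instance_def sum.distrib)
qed

text \<open>The majority sign turns each difference into its absolute value; on a tie the difference
  is 0, so the choice made there is harmless.\<close>

lemma bias_eq_sum_list:
  assumes "max2and_instance n \<Psi>"
  shows "2 * bias n \<Psi> = (\<Sum>(l, l')\<leftarrow>\<Psi>. lit_sign (majority \<Psi>) l + lit_sign (majority \<Psi>) l')"
  unfolding sum_lit_sign[OF assms] bias_def
  by (auto simp: majority_def intro!: sum.cong)

lemma val_ge_quadratic:
  assumes "max2and_instance n \<Psi>" and g: "0 \<le> g" "g \<le> 1/2"
  shows "real (val n \<Psi>) \<ge> real (length \<Psi>) / 4 + g * bias n \<Psi> - g\<^sup>2 * (real (length \<Psi>) - 2 * bias n \<Psi>)"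
proof -
  define \<tau> where "\<tau> = majority \<Psi>"
  let ?A = "{1..n} \<rightarrow>\<^sub>E (UNIV :: bool set)" and ?w = "shifted_weight \<tau> g"
  let ?s = "\<lambda>(l, l'). lit_sign \<tau> l + lit_sign \<tau> l'"
  have clause: "(1/4 - g\<^sup>2) + (g/2 + g\<^sup>2) * ?s c
      \<le> (\<Sum>\<sigma>\<in>?A. assignment_weight ?w {1..n} \<sigma> * of_bool (clause_true \<sigma> c))"
    if "c \<in> set \<Psi>" for c
  proof -
    obtain l l' where c: "c = (l, l')" by fastforce
    \<comment> \<open>This is (1 - s) (1 - s') \<ge> 0 expanded. The resulting clause bound is
      affine in s + s', so its sum over all clauses depends only on the length and the bias.\<close>
    have "lit_sign \<tau> l * lit_sign \<tau> l' \<ge> lit_sign \<tau> l + lit_sign \<tau> l' - 1"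
      by (simp add: lit_sign_def)
    then have "g\<^sup>2 * (lit_sign \<tau> l * lit_sign \<tau> l') \<ge> g\<^sup>2 * (lit_sign \<tau> l + lit_sign \<tau> l' - 1)"
      by (intro mult_left_mono) auto
    then have "(1/4 - g\<^sup>2) + (g/2 + g\<^sup>2) * ?s c \<le> (1/2 + g * lit_sign \<tau> l) * (1/2 + g * lit_sign \<tau> l')"
      by (simp add: c algebra_simps power2_eq_square)
    also have "\<dots> \<le> (\<Sum>\<sigma>\<in>?A. assignment_weight ?w {1..n} \<sigma> * of_bool (clause_true \<sigma> c))"
      unfolding c using assms that c by (intro clause_probability_ge) (auto simp: max2and_instance_def)
    finally show ?thesis .
  qed
  have "real (length \<Psi>) / 4 + g * bias n \<Psi> - g\<^sup>2 * (real (length \<Psi>) - 2 * bias n \<Psi>)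
      = (1/4 - g\<^sup>2) * real (length \<Psi>) + (g/2 + g\<^sup>2) * (\<Sum>c\<leftarrow>\<Psi>. ?s c)"
    using bias_eq_sum_list[OF assms(1)] by (simp add: \<tau>_def[symmetric] algebra_simps)
  also have "\<dots> = (\<Sum>c\<leftarrow>\<Psi>. (1/4 - g\<^sup>2) + (g/2 + g\<^sup>2) * ?s c)"
    by (simp only: sum_list_addf sum_list_const_mult sum_list_triv) simp
  also have "\<dots> \<le> (\<Sum>c\<leftarrow>\<Psi>. \<Sum>\<sigma>\<in>?A. assignment_weight ?w {1..n} \<sigma> * of_bool (clause_true \<sigma> c))"
    by (intro sum_list_mono clause)
  \<comment> \<open>Linearity of expectation: the sums over clauses and over assignments are
    exchanged.\<close>
  also have "\<dots> = (\<Sum>\<sigma>\<in>?A. assignment_weight ?w {1..n} \<sigma> * real (num_sat \<sigma> \<Psi>))"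
    unfolding num_sat_eq_sum_list by (induction \<Psi>) (auto simp: sum.distrib algebra_simps)
  also have "\<dots> \<le> real (val n \<Psi>)"
    using g by (intro expected_num_sat_le_val) (auto simp: shifted_weight_def)
  finally show ?thesis .
qed

theorem lemma3p3:
  fixes n m :: nat and \<Psi> :: "clause list"
  assumes "max2and_instance n \<Psi>"
    and "length \<Psi> = m"
    and "m \<ge> 1"
    and "bias n \<Psi> \<le> real m / 3"
  shows "real (val n \<Psi>) \<ge> real m / 4 + (bias n \<Psi>)\<^sup>2 / (4 * (real m - 2 * bias n \<Psi>))
       \<and> real m / 4 + (bias n \<Psi>)\<^sup>2 / (4 * (real m - 2 * bias n \<Psi>))
           \<ge> 2 * (real m + bias n \<Psi>) / 9"
proof -
  define B M where "B = bias n \<Psi>" and "M = real m"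
  define D g where "D = M - 2 * B" and "g = B / (2 * D)"
  have B: "0 \<le> B" "3 * B \<le> M" and M: "M \<ge> 1"
    using assms by (auto simp: B_def M_def bias_def intro!: sum_nonneg)
  \<comment> \<open>From 3 B \<le> M follows D \<ge> M/3 > 0, and B \<le> D is the same inequality
    rearranged; it yields g \<le> 1/2.\<close>
  then have D: "D > 0" and "B \<le> D" by (auto simp: D_def)
  then have g: "0 \<le> g" "g \<le> 1/2" using B by (auto simp: g_def field_simps)
  have "M / 4 + g * B - g\<^sup>2 * D \<le> real (val n \<Psi>)"
    using val_ge_quadratic[OF assms(1) g] assms(2) by (simp add: B_def M_def D_def)
  moreover have "g * B - g\<^sup>2 * D = B\<^sup>2 / (4 * D)"
    using D by (simp add: g_def field_simps power2_eq_square)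
  ultimately have 1: "M / 4 + B\<^sup>2 / (4 * D) \<le> real (val n \<Psi>)" by linarith
  \<comment> \<open>Over the common denominator 36 D the numerator of the difference is a perfect
    square, which vanishes exactly when M = 5 B.\<close>
  have "M / 4 + B\<^sup>2 / (4 * D) - 2 * (M + B) / 9 = (9 * M * D + 9 * B\<^sup>2 - 8 * (M + B) * D) / (36 * D)"
    using D by (simp add: field_simps)
  also have "9 * M * D + 9 * B\<^sup>2 - 8 * (M + B) * D = (M - 5 * B)\<^sup>2"
    by (simp add: D_def algebra_simps power2_eq_square)
  also have "(M - 5 * B)\<^sup>2 / (36 * D) \<ge> 0" using D by simp
  finally have "2 * (M + B) / 9 \<le> M / 4 + B\<^sup>2 / (4 * D)" by simp
  with 1 show ?thesis by (simp add: B_def M_def D_def)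
qed

end
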